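(* Let $\mathfrak B$ be a Banach space and $(A,f)\in C(\mathbb R,[\mathfrak B])\times C(\mathbb R,\mathfrak B)$. Let $\tau_0>0$. Assume that $(A,f)$ is Lagrange stable and two-sided remotely almost periodic (respectively, two-sided remotely $\tau_0$-periodic, or two-sided remotely stationary), and that the linear equation $x'=A(t)x$ has an exponential trichotomy on $\mathbb R$. Then: (1) the equation $x'=A(t)x+f(t)$ has at least one two-sided remotely almost periodic (respectively, two-sided remotely $\tau_0$-periodic, or two-sided remotely stationary) solution $\varphi$ on $\mathbb R$; (2) the solution $\varphi$ is given by $\varphi(t)=\int_{-\infty}^{+\infty}G_A(t,\tau)f(\tau)\,d\tau$ ($t\in\mathbb R$), where $G_A$ is the Green function associated with the trichotomy; (3) every solution of $x'=A(t)x+f(t)$ that is bounded on $\mathbb R$ is two-sided remotely almost periodic (respectively, two-sided remotely $\tau_0$-periodic, or two-sided remotely stationary).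
   Context: $\mathfrak B$ is a real or complex Banach space with norm $|\cdot|$; $[\mathfrak B]$ is the Banach space of bounded linear operators on $\mathfrak B$ with the operator norm. For a metric space $(E,\rho)$, $C(\mathbb R,E)$ carries the topology of uniform convergence on compact subsets of $\mathbb R$, and $g^h(t):=g(t+h)$. A function $g\in C(\mathbb R,E)$ is Lagrange stable if $\{g^h: h\in\mathbb R\}$ is precompact in $C(\mathbb R,E)$; the pair $(A,f)$ is regarded as an element of $C(\mathbb R,[\mathfrak B]\times\mathfrak B)$. A set $S\subseteq\mathbb R$ is relatively dense in $\mathbb R$ if there is $l>0$ with $[a,a+l]\cap S\neq\emptyset$ for all $a\in\mathbb R$. A function $g\in C(\mathbb R,E)$ is: two-sided remotely almost periodic if for every $\varepsilon>0$ there is a relatively dense set $\mathcal P(\varepsilon,g)\subseteq\mathbb R$ such that for every $s\in\mathcal P(\varepsilon,g)$ there is $L(\varepsilon,g,s)>0$ with $\rho(g(t+s),g(t))<\varepsilon$ for all $|t|\ge L(\varepsilon,g,s)$; two-sided remotely $\tau_0$-periodic if $\lim_{|t|\to\infty}\rho(g(t+\tau_0),g(t))=0$; two-sided remotely stationary if it is two-sided remotely $s$-periodic for every $s>0$. $U(t,A)$ denotes the Cauchy operator of $x'=A(t)x$ (so $U(0,A)=I$ and $t\mapsto U(t,A)x$ is the solution with value $x$ at $t=0$). The equation $x'=A(t)x$ has an exponential trichotomy on $\mathbb R$ if there are bounded linear projections $P,Q$ on $\mathfrak B$ with $PQ=QP$, $P+Q-PQ=I$, and constants $\mathcal N\ge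 1$, $\nu>0$ such that $\|U(t,A)PU^{-1}(\tau,A)\|\le\mathcal N e^{-\nu(t-\tau)}$ for $0\le\tau\le t$; $\|U(t,A)(I-P)U^{-1}(\tau,A)\|\le\mathcal N e^{-\nu(\tau-t)}$ for $t\le\tau$, $\tau\ge0$; $\|U(t,A)QU^{-1}(\tau,A)\|\le\mathcal N e^{-\nu(\tau-t)}$ for $t\le\tau\le0$; $\|U(t,A)(I-Q)U^{-1}(\tau,A)\|\le\mathcal N e^{-\nu(t-\tau)}$ for $\tau\le t$, $\tau\le0$. The associated Green function is: $G_A(t,\tau)=U(t,A)PU^{-1}(\tau,A)$ if $0\le\tau<t$; $G_A(t,\tau)=-U(t,A)(I-P)U^{-1}(\tau,A)$ if $t\le\tau$, $\tau\ge0$; $G_A(t,\tau)=-U(t,A)QU^{-1}(\tau,A)$ if $t\le\tau\le0$; $G_A(t,\tau)=U(t,A)(I-Q)U^{-1}(\tau,A)$ if $\tau\le t$, $\tau\le0$ (the cases overlap only for $\tau=0$ or $\tau=t$, which does not affect the integral). *)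

theory Defs
  imports "HOL-Analysis.Analysis"
begin

text \<open>
  The Banach space is a type of class \<open>banach\<close>, i.e. a real Banach space. A complex Banach space
  is covered through its underlying real space: norm, operator norm, limits, solutions and integrals
  are the same, and complex-linear operators and projections are in particular real-linear.
\<close>

section \<open>Functions on the line with values in a metric space\<close>

definition ucc_open :: "(real \<Rightarrow> 'e::metric_space) set \<Rightarrow> bool" where
  "ucc_open W \<longleftrightarrow> W \<subseteq> {g. continuous_on UNIV g} \<and>
     (\<forall>g\<in>W. \<exists>K \<epsilon>. compact K \<and> \<epsilon> > 0 \<and>
        {h. continuous_on UNIV h \<and> (\<forall>t\<in>K. dist (h t) (g t) < \<epsilon>)} \<subseteq> W)"

lemma istopology_ucc_open: "istopology ucc_open"
  unfolding istopology_def
proof (intro conjI allI impI)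
  fix S T :: "(real \<Rightarrow> 'a) set"
  assume S: "ucc_open S" and T: "ucc_open T"
  show "ucc_open (S \<inter> T)"
    unfolding ucc_open_def
  proof (intro conjI ballI)
    show "S \<inter> T \<subseteq> {g. continuous_on UNIV g}"
      using S unfolding ucc_open_def by blast
    fix g assume g: "g \<in> S \<inter> T"
    obtain K1 e1 where 1: "compact K1" "e1 > 0"
        "{h. continuous_on UNIV h \<and> (\<forall>t\<in>K1. dist (h t) (g t) < e1)} \<subseteq> S"
      using S g unfolding ucc_open_def by blast
    obtain K2 e2 where 2: "compact K2" "e2 > 0"
        "{h. continuous_on UNIV h \<and> (\<forall>t\<in>K2. dist (h t) (g t) < e2)} \<subseteq> T"
      using T g unfolding ucc_open_def by blast
    have "{h. continuous_on UNIV h \<and> (\<forall>t\<in>K1 \<union> K2. dist (h t) (g t) < min e1 e2)} \<subseteq> S \<inter> T"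
      by (rule order_trans[OF _ Int_mono[OF 1(3) 2(3)]]) (simp add: subset_iff)
    moreover have "compact (K1 \<union> K2)" "min e1 e2 > 0"
      using 1 2 by auto
    ultimately show "\<exists>K \<epsilon>. compact K \<and> \<epsilon> > 0 \<and>
        {h. continuous_on UNIV h \<and> (\<forall>t\<in>K. dist (h t) (g t) < \<epsilon>)} \<subseteq> S \<inter> T"
      by blast
  qed
next
  fix \<K> :: "(real \<Rightarrow> 'a) set set"
  assume K: "\<forall>K\<in>\<K>. ucc_open K"
  show "ucc_open (\<Union>\<K>)"
    unfolding ucc_open_def
  proof (intro conjI ballI)
    show "\<Union>\<K> \<subseteq> {g. continuous_on UNIV g}"
      using K unfolding ucc_open_def by blast
    fix g assume "g \<in> \<Union>\<K>"
    then obtain W where W: "W \<in> \<K>" "g \<in> W" by blast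
    then have "ucc_open W" using K by blast
    from this[unfolded ucc_open_def, THEN conjunct2, THEN bspec, OF W(2)]
    obtain C e where C: "compact C" "e > 0"
        and sub: "{h. continuous_on UNIV h \<and> (\<forall>t\<in>C. dist (h t) (g t) < e)} \<subseteq> W"
      by (elim exE conjE)
    have "{h. continuous_on UNIV h \<and> (\<forall>t\<in>C. dist (h t) (g t) < e)} \<subseteq> \<Union>\<K>"
      using sub Union_upper[OF W(1)] by (rule order_trans)
    with C show "\<exists>K \<epsilon>. compact K \<and> \<epsilon> > 0 \<and>
        {h. continuous_on UNIV h \<and> (\<forall>t\<in>K. dist (h t) (g t) < \<epsilon>)} \<subseteq> \<Union>\<K>"
      by (intro exI conjI)
  qed
qed

text \<open>The space \<open>C(\<real>,E)\<close> with uniform convergence on compact subsets.\<close>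

definition ucc_topology :: "(real \<Rightarrow> 'e::metric_space) topology" where
  "ucc_topology = topology ucc_open"

lemma openin_ucc_topology: "openin ucc_topology = ucc_open"
  unfolding ucc_topology_def by (rule topology_inverse'[OF istopology_ucc_open])

lemma topspace_ucc_topology: "topspace ucc_topology = {g. continuous_on UNIV g}"
proof -
  have "ucc_open {g :: real \<Rightarrow> 'a. continuous_on UNIV g}"
    unfolding ucc_open_def
  proof (intro conjI ballI exI)
    show "compact ({} :: real set)" "(1 :: real) > 0" by simp_all
  qed simp_all
  moreover have "W \<subseteq> {g. continuous_on UNIV g}" if "ucc_open W" for W :: "(real \<Rightarrow> 'a) set"
    using that unfolding ucc_open_def by (rule conjunct1)
  ultimately show ?thesis
    unfolding topspace_def openin_ucc_topology
    by (intro equalityI Union_least Union_upper) simp_all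
qed

definition translate :: "real \<Rightarrow> (real \<Rightarrow> 'e) \<Rightarrow> (real \<Rightarrow> 'e)" where
  "translate h g = (\<lambda>t. g (t + h))"

definition lagrange_stable :: "(real \<Rightarrow> 'e::metric_space) \<Rightarrow> bool" where
  "lagrange_stable g \<longleftrightarrow> continuous_on UNIV g \<and>
     compactin ucc_topology (ucc_topology closure_of {translate h g | h. h \<in> UNIV})"

definition relatively_dense :: "real set \<Rightarrow> bool" where
  "relatively_dense S \<longleftrightarrow> (\<exists>l>0. \<forall>a. {a..a + l} \<inter> S \<noteq> {})"

definition remotely_almost_periodic :: "(real \<Rightarrow> 'e::metric_space) \<Rightarrow> bool" where
  "remotely_almost_periodic g \<longleftrightarrow> continuous_on UNIV g \<and>
     (\<forall>\<epsilon>>0. \<exists>S. relatively_dense S \<and>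
        (\<forall>s\<in>S. \<exists>L>0. \<forall>t. \<bar>t\<bar> \<ge> L \<longrightarrow> dist (g (t + s)) (g t) < \<epsilon>))"

text \<open>On \<open>\<real>\<close>, the filter \<open>at_infinity\<close> expresses \<open>\<bar>t\<bar> \<rightarrow> \<infinity>\<close>.\<close>

definition remotely_periodic :: "real \<Rightarrow> (real \<Rightarrow> 'e::metric_space) \<Rightarrow> bool" where
  "remotely_periodic \<tau> g \<longleftrightarrow> continuous_on UNIV g \<and>
     ((\<lambda>t. dist (g (t + \<tau>)) (g t)) \<longlongrightarrow> 0) at_infinity"

definition remotely_stationary :: "(real \<Rightarrow> 'e::metric_space) \<Rightarrow> bool" where
  "remotely_stationary g \<longleftrightarrow> (\<forall>s>0. remotely_periodic s g)"

section \<open>Linear differential equations\<close>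

definition linear_ode_solution ::
  "(real \<Rightarrow> 'a \<Rightarrow>\<^sub>L 'a) \<Rightarrow> (real \<Rightarrow> 'a) \<Rightarrow> (real \<Rightarrow> 'a::banach) \<Rightarrow> bool" where
  "linear_ode_solution A f x \<longleftrightarrow>
     (\<forall>t. (x has_vector_derivative (blinfun_apply (A t) (x t) + f t)) (at t))"

text \<open>For continuous \<open>A\<close> the function described below exists and is unique (global existence and
  uniqueness for linear equations), and all its values are invertible.\<close>

definition cauchy_operator ::
  "(real \<Rightarrow> 'a \<Rightarrow>\<^sub>L 'a) \<Rightarrow> real \<Rightarrow> ('a::banach \<Rightarrow>\<^sub>L 'a)" where
  "cauchy_operator A =
     (THE U. U 0 = id_blinfun \<and>
        (\<forall>x. linear_ode_solution A (\<lambda>t. 0) (\<lambda>t. blinfun_apply (U t) x)))"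

definition blinfun_inverse :: "('a \<Rightarrow>\<^sub>L 'a) \<Rightarrow> ('a::real_normed_vector \<Rightarrow>\<^sub>L 'a)" where
  "blinfun_inverse W = (THE V. V o\<^sub>L W = id_blinfun \<and> W o\<^sub>L V = id_blinfun)"

text \<open>\<open>evolution A R t \<tau>\<close> is \<open>U(t,A) R U\<^sup>-\<^sup>1(\<tau>,A)\<close>.\<close>

definition evolution ::
  "(real \<Rightarrow> 'a \<Rightarrow>\<^sub>L 'a) \<Rightarrow> ('a \<Rightarrow>\<^sub>L 'a) \<Rightarrow> real \<Rightarrow> real \<Rightarrow> ('a::banach \<Rightarrow>\<^sub>L 'a)" where
  "evolution A R t \<tau> = cauchy_operator A t o\<^sub>L R o\<^sub>L blinfun_inverse (cauchy_operator A \<tau>)"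

definition exponential_trichotomy_with ::
  "(real \<Rightarrow> 'a \<Rightarrow>\<^sub>L 'a) \<Rightarrow> ('a \<Rightarrow>\<^sub>L 'a) \<Rightarrow> ('a::banach \<Rightarrow>\<^sub>L 'a) \<Rightarrow> bool" where
  "exponential_trichotomy_with A P Q \<longleftrightarrow>
     P o\<^sub>L P = P \<and> Q o\<^sub>L Q = Q \<and> P o\<^sub>L Q = Q o\<^sub>L P \<and> P + Q - (P o\<^sub>L Q) = id_blinfun \<and>
     (\<exists>N \<nu>. N \<ge> 1 \<and> \<nu> > 0 \<and>
       (\<forall>t \<tau>. 0 \<le> \<tau> \<and> \<tau> \<le> t \<longrightarrow>
          norm (evolution A P t \<tau>) \<le> N * exp (- \<nu> * (t - \<tau>))) \<and>
       (\<forall>t \<tau>. t \<le> \<tau> \<and> 0 \<le> \<tau> \<longrightarrow>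
          norm (evolution A (id_blinfun - P) t \<tau>) \<le> N * exp (- \<nu> * (\<tau> - t))) \<and>
       (\<forall>t \<tau>. t \<le> \<tau> \<and> \<tau> \<le> 0 \<longrightarrow>
          norm (evolution A Q t \<tau>) \<le> N * exp (- \<nu> * (\<tau> - t))) \<and>
       (\<forall>t \<tau>. \<tau> \<le> t \<and> \<tau> \<le> 0 \<longrightarrow>
          norm (evolution A (id_blinfun - Q) t \<tau>) \<le> N * exp (- \<nu> * (t - \<tau>))))"

text \<open>The usual four cases overlap only for \<open>\<tau> = 0\<close> or \<open>\<tau> = t\<close>; there the first applicable case
  is taken, which does not affect the integral in \<open>\<tau>\<close>.\<close>

definition green_function ::
  "(real \<Rightarrow> 'a \<Rightarrow>\<^sub>L 'a) \<Rightarrow> ('a \<Rightarrow>\<^sub>L 'a) \<Rightarrow> ('a \<Rightarrow>\<^sub>L 'a) \<Rightarrow>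
     real \<Rightarrow> real \<Rightarrow> ('a::banach \<Rightarrow>\<^sub>L 'a)" where
  "green_function A P Q t \<tau> =
     (if 0 \<le> \<tau> \<and> \<tau> < t then evolution A P t \<tau>
      else if t \<le> \<tau> \<and> 0 \<le> \<tau> then - evolution A (id_blinfun - P) t \<tau>
      else if t \<le> \<tau> \<and> \<tau> \<le> 0 then - evolution A Q t \<tau>
      else evolution A (id_blinfun - Q) t \<tau>)"

end

theory Submission
  imports Defs "HOL-Real_Asymp.Real_Asymp"
begin

text \<open>
  If \<open>x\<close> is a bounded solution, then \<open>y t = x (t + s) - x t\<close> is a bounded solution of
  \<open>y' = A(t) y + h(t)\<close> with \<open>h(t) = (A(t + s) - A(t)) x(t + s) + f(t + s) - f(t)\<close>. The trichotomy
  restricts to a dichotomy on each half line, and there the variation-of-constants formula bounds a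
  bounded solution by a decaying term plus a constant times the supremum of \<open>h\<close> far out. So \<open>x\<close>
  inherits from \<open>(A, f)\<close> every remote almost period, with \<open>\<epsilon>\<close> multiplied by a constant that
  depends neither on \<open>s\<close> nor on \<open>\<epsilon>\<close>. Lagrange stability makes \<open>f\<close> bounded, so the
  Green integral is itself a bounded solution.
\<close>

section \<open>Linear equations with continuous coefficients\<close>

lemma has_antiderivative_UNIV:
  fixes f :: "real \<Rightarrow> 'a::banach"
  assumes "continuous_on UNIV f"
  obtains F where "F 0 = 0" and "\<And>t. (F has_vector_derivative f t) (at t)"
proof -
  \<comment> \<open>Integrals over empty intervals vanish, so the difference is the oriented
    integral from \<open>0\<close> to \<open>t\<close> for either sign of \<open>t\<close>.\<close>
  define F where "F t = integral {0..t} f - integral {t..0} f" for t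
  have F0: "F 0 = 0" by (simp add: F_def)
  have cont: "continuous_on X f" for X
    using assms continuous_on_subset by blast
  then have int: "f integrable_on {a..b}" for a b
    by (intro integrable_continuous_real)
  \<comment> \<open>To the right of \<open>-n\<close>, \<open>F\<close> differs by a constant from
    the integral with fixed left endpoint \<open>-n\<close>, so the fundamental theorem on a compact
    interval applies on both sides of \<open>0\<close>.\<close>
  have eq: "F t = integral {-n..t} f - integral {-n..0} f" if "-n < t" "0 < n" for t n
  proof (cases "0 \<le> t")
    case True
    then have "integral {-n..0} f + integral {0..t} f = integral {-n..t} f"
      using that int by (intro Henstock_Kurzweil_Integration.integral_combine) auto
    moreover have "integral {t..0} f = 0"
      using True by (cases "t = 0") auto
    ultimately show ?thesis by (simp add: F_def algebra_simps)
  next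
    case False
    then have "integral {-n..t} f + integral {t..0} f = integral {-n..0} f"
      using that int by (intro Henstock_Kurzweil_Integration.integral_combine) auto
    moreover have "integral {0..t} f = 0"
      using False by auto
    ultimately show ?thesis by (simp add: F_def algebra_simps)
  qed
  have "(F has_vector_derivative f t) (at t)" for t
  proof -
    define n where "n = \<bar>t\<bar> + 1"
    have t: "t \<in> {-n<..<n}" "t \<in> {-n..n}" "0 < n"
      unfolding n_def by auto
    have "((\<lambda>u. integral {-n..u} f) has_vector_derivative f t) (at t within {-n..n})"
      using integral_has_vector_derivative[OF cont t(2)] .
    then have "((\<lambda>u. integral {-n..u} f) has_vector_derivative f t) (at t within {-n<..<n})"
      by (rule has_vector_derivative_within_subset) auto
    then have "((\<lambda>u. integral {-n..u} f) has_vector_derivative f t) (at t)"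
      using t(1) by (metis at_within_open open_greaterThanLessThan)
    then have "((\<lambda>u. integral {-n..u} f - integral {-n..0} f) has_vector_derivative f t - 0) (at t)"
      by (intro has_vector_derivative_diff has_vector_derivative_const)
    then have "((\<lambda>u. integral {-n..u} f - integral {-n..0} f) has_vector_derivative f t) (at t)"
      by simp
    then show ?thesis
      by (rule has_vector_derivative_transform_within_open[of _ _ _ "{-n<..<n}"])
        (use eq t in auto)
  qed
  with F0 show ?thesis by (rule that)
qed

text \<open>The substitution \<open>r * t\<close> turns the segment from \<open>0\<close> to
  \<open>t\<close> into the unit interval, so one mean value inequality handles both signs of
  \<open>t\<close>. Iterating the estimate produces the factorials in the Picard bounds.\<close>

lemma norm_antiderivative_le_power:
  fixes F f :: "real \<Rightarrow> 'a::real_normed_vector"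
  assumes F: "\<And>s. (F has_vector_derivative f s) (at s)"
    and bnd: "\<And>s. \<bar>s\<bar> \<le> \<bar>t\<bar> \<Longrightarrow> norm (f s) \<le> C * \<bar>s\<bar> ^ n"
  shows "norm (F t - F 0) \<le> C * \<bar>t\<bar> ^ Suc n / real (Suc n)"
proof -
  let ?\<phi> = "\<lambda>r. C * \<bar>t\<bar> ^ Suc n / real (Suc n) * r ^ Suc n"
  have F': "((\<lambda>r. F (r * t)) has_vector_derivative t *\<^sub>R f (r * t)) (at r)" for r
  proof -
    have "((\<lambda>r. r * t) has_vector_derivative t) (at r)"
      by (auto intro!: derivative_eq_intros simp: has_real_derivative_iff_has_vector_derivative[symmetric])
    from vector_diff_chain_at[OF this F[of "r * t"]] show ?thesis
      by (simp add: o_def)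
  qed
  have phi': "(?\<phi> has_vector_derivative C * \<bar>t\<bar> ^ Suc n * r ^ n) (at r)" for r
    unfolding has_real_derivative_iff_has_vector_derivative[symmetric]
    by (rule DERIV_cmult[OF DERIV_pow[of "Suc n" r], THEN DERIV_cong])
      (simp del: of_nat_Suc)
  have "norm (F (1 * t) - F (0 * t)) \<le> ?\<phi> 1 - ?\<phi> 0"
  proof (rule differentiable_bound_general[where f = "\<lambda>r. F (r * t)" and \<phi> = ?\<phi>])
    show "continuous_on {0..1} (\<lambda>r. F (r * t))" "continuous_on {0..1} ?\<phi>"
      using F' phi' by (meson continuous_at_imp_continuous_on has_vector_derivative_continuous)+
    fix r :: real assume r: "0 < r" "r < 1"
    show "((\<lambda>r. F (r * t)) has_vector_derivative t *\<^sub>R f (r * t)) (at r)" by (rule F')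
    show "(?\<phi> has_vector_derivative C * \<bar>t\<bar> ^ Suc n * r ^ n) (at r)" by (rule phi')
    have "norm (f (r * t)) \<le> C * \<bar>r * t\<bar> ^ n"
      using r by (intro bnd) (simp add: abs_mult mult_left_le_one_le)
    then have "\<bar>t\<bar> * norm (f (r * t)) \<le> \<bar>t\<bar> * (C * \<bar>r * t\<bar> ^ n)"
      by (intro mult_left_mono) auto
    then show "norm (t *\<^sub>R f (r * t)) \<le> C * \<bar>t\<bar> ^ Suc n * r ^ n"
      using r by (simp add: abs_mult power_mult_distrib mult_ac)
  qed simp
  then show ?thesis by simp
qed

text \<open>The solution is the sum of the Picard iterates, whose \<open>n\<close>-th term is of order
  \<open>(c \<bar>t\<bar>)\<^sup>n / n!\<close> on each bounded interval.\<close>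

lemma bilinear_ode_solution_exists:
  fixes prod :: "'c::real_normed_vector \<Rightarrow> 'b::banach \<Rightarrow> 'b" and A :: "real \<Rightarrow> 'c"
  assumes "bounded_bilinear prod" and A: "continuous_on UNIV A"
  obtains x where "x 0 = x0" "\<And>t. (x has_vector_derivative prod (A t) (x t)) (at t)"
proof -
  interpret bounded_bilinear prod by fact
  define J where "J g = (SOME F. F 0 = 0 \<and> (\<forall>t. (F has_vector_derivative g t) (at t)))"
    for g :: "real \<Rightarrow> 'b"
  have J: "J g 0 = 0" "(J g has_vector_derivative g t) (at t)" if "continuous_on UNIV g" for g t
  proof -
    have "\<exists>F. F 0 = 0 \<and> (\<forall>t. (F has_vector_derivative g t) (at t))"
      using has_antiderivative_UNIV[OF that] by metis
    from someI_ex[OF this] show "J g 0 = 0" "(J g has_vector_derivative g t) (at t)"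
      by (auto simp: J_def)
  qed
  \<comment> \<open>These are the increments between successive Picard iterates: each is the
    antiderivative, vanishing at \<open>0\<close>, of \<open>A\<close> applied to the preceding
    one.\<close>
  define I where "I = rec_nat (\<lambda>t. x0) (\<lambda>n g. J (\<lambda>t. prod (A t) (g t)))"
  have I0: "I 0 = (\<lambda>t. x0)" and ISuc: "I (Suc n) = J (\<lambda>t. prod (A t) (I n t))" for n
    by (simp_all add: I_def)
  have contI: "continuous_on UNIV (I n)" for n
  proof (induction n)
    case (Suc n)
    have "(I (Suc n) has_vector_derivative prod (A t) (I n t)) (at t)" for t
      unfolding ISuc by (intro J continuous_on A Suc)
    then show ?case
      by (meson continuous_at_imp_continuous_on has_vector_derivative_continuous)
  qed (simp add: I0)
  have I': "(I (Suc n) has_vector_derivative prod (A t) (I n t)) (at t)"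
    and ISuc0: "I (Suc n) 0 = 0" for n t
    unfolding ISuc by (intro J continuous_on A contI)+
  obtain K where K: "0 < K" "\<And>a b. norm (prod a b) \<le> norm a * norm b * K"
    using pos_bounded by blast
  \<comment> \<open>The derivatives of the terms. Since \<open>I 0\<close> is constant, the index
    shift costs only a zero term, and the sum of the \<open>D n t\<close> is \<open>A t\<close>
    applied to the sum of the \<open>I n t\<close>.\<close>
  define D where "D n t = (case n of 0 \<Rightarrow> 0 | Suc m \<Rightarrow> prod (A t) (I m t))" for n t
  have D: "(I n has_vector_derivative D n t) (at t)" for n t
    by (cases n) (auto simp: D_def I0 I')
  \<comment> \<open>On a bounded interval \<open>A\<close> is bounded, which yields a uniform
    majorant; \<open>T\<close> is arbitrary, so every \<open>t\<close> is reached.\<close>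
  have main: "(\<lambda>n. I n t) sums (\<Sum>n. I n t) \<and>
      ((\<lambda>s. \<Sum>n. I n s) has_vector_derivative prod (A t) (\<Sum>n. I n t)) (at t)"
    if t: "\<bar>t\<bar> < T" for t T
  proof -
    let ?S = "{-T<..<T}"
    have "bounded (A ` {-T..T})"
      by (intro compact_imp_bounded compact_continuous_image continuous_on_subset[OF A]) auto
    then obtain \<alpha> where \<alpha>: "\<And>s. s \<in> {-T..T} \<Longrightarrow> norm (A s) \<le> \<alpha>" "0 < \<alpha>"
      unfolding bounded_pos by blast
    define c where "c = \<alpha> * K"
    have c: "0 < c" using \<alpha> K by (simp add: c_def)
    have prod_le: "norm (prod (A s) y) \<le> c * norm y" if "s \<in> {-T..T}" for s y
    proof -
      have "norm (prod (A s) y) \<le> norm (A s) * (norm y * K)"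
        using K(2)[of "A s" y] by (simp add: mult_ac)
      also have "\<dots> \<le> \<alpha> * (norm y * K)"
        using \<alpha>(1)[OF that] K by (intro mult_right_mono) auto
      finally show ?thesis by (simp add: c_def mult_ac)
    qed
    have bnd: "norm (I n s) \<le> norm x0 * c ^ n / fact n * \<bar>s\<bar> ^ n" if "s \<in> {-T..T}" for n s
      using that
    proof (induction n arbitrary: s)
      case (Suc n)
      have "norm (I (Suc n) s - I (Suc n) 0)
          \<le> (c * (norm x0 * c ^ n / fact n)) * \<bar>s\<bar> ^ Suc n / real (Suc n)"
      proof (rule norm_antiderivative_le_power[OF I'])
        fix r assume "\<bar>r\<bar> \<le> \<bar>s\<bar>"
        with Suc.prems have r: "r \<in> {-T..T}" by auto
        have "norm (prod (A r) (I n r)) \<le> c * norm (I n r)" by (rule prod_le[OF r])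
        also have "\<dots> \<le> c * (norm x0 * c ^ n / fact n * \<bar>r\<bar> ^ n)"
          using c by (intro mult_left_mono Suc.IH r) auto
        finally show "norm (prod (A r) (I n r)) \<le> c * (norm x0 * c ^ n / fact n) * \<bar>r\<bar> ^ n"
          by (simp add: mult_ac)
      qed
      then show ?case by (simp add: ISuc0 field_simps)
    qed (simp add: I0)
    \<comment> \<open>The bound at the endpoint \<open>T\<close>: up to the factor
      \<open>norm x0\<close>, the terms of the exponential series at \<open>c * T\<close>.\<close>
    define M where "M n = norm x0 * ((c * T) ^ n / fact n)" for n
    have summM: "summable M"
      unfolding M_def using summable_exp[of "c * T"]
      by (intro summable_mult) (simp add: field_simps)
    have bndM: "norm (I n s) \<le> M n" if s: "s \<in> ?S" for n s
    proof -
      have "norm (I n s) \<le> norm x0 * c ^ n / fact n * \<bar>s\<bar> ^ n"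
        using s by (intro bnd) auto
      also have "\<dots> \<le> norm x0 * c ^ n / fact n * T ^ n"
        using s c by (intro mult_left_mono power_mono) auto
      finally show ?thesis by (simp add: M_def power_mult_distrib)
    qed
    have summI: "summable (\<lambda>n. I n s)" if "s \<in> ?S" for s
      by (rule summable_comparison_test'[OF summM, of 0]) (rule bndM[OF that])
    have sumsD: "(\<lambda>n. D n s) sums prod (A s) (\<Sum>n. I n s)" if "s \<in> ?S" for s
    proof -
      have "(\<lambda>n. prod (A s) (I n s)) sums prod (A s) (\<Sum>n. I n s)"
        by (rule bounded_linear.sums[OF bounded_linear_right summable_sums[OF summI[OF that]]])
      then have "(\<lambda>n. D (Suc n) s) sums prod (A s) (\<Sum>n. I n s)"
        by (simp add: D_def)
      then show ?thesis
        by (subst (asm) sums_Suc_iff) (simp add: D_def)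
    qed
    define M' where "M' n = (case n of 0 \<Rightarrow> 0 | Suc m \<Rightarrow> c * M m)" for n
    have "summable M'"
      using summable_mult[OF summM, of c] by (subst summable_Suc_iff[symmetric]) (simp add: M'_def)
    moreover have "norm (D n s) \<le> M' n" if s: "s \<in> ?S" for n s
    proof (cases n)
      case (Suc m)
      have "norm (prod (A s) (I m s)) \<le> c * norm (I m s)" using s by (intro prod_le) auto
      also have "\<dots> \<le> c * M m" using c s by (intro mult_left_mono bndM) auto
      finally show ?thesis by (simp add: Suc D_def M'_def)
    qed (simp add: D_def M'_def)
    ultimately have "uniform_limit ?S (\<lambda>n s. \<Sum>i<n. D i s) (\<lambda>s. suminf (\<lambda>i. D i s)) sequentially"
      by (intro Weierstrass_m_test)
    then have unif: "uniform_limit ?S (\<lambda>n s. \<Sum>i<n. D i s) (\<lambda>s. prod (A s) (\<Sum>n. I n s)) sequentially"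
      by (rule uniform_limit_cong'[THEN iffD1, rotated -1]) (auto simp: sums_unique[OF sumsD])
    have tS: "t \<in> ?S" using t by auto
    \<comment> \<open>Termwise differentiation is legitimate because the series of derivatives
      converges uniformly by the M-test.\<close>
    have "\<exists>g. \<forall>s\<in>?S. (\<lambda>n. I n s) sums g s \<and>
        (g has_derivative (\<lambda>h. h *\<^sub>R prod (A s) (\<Sum>n. I n s))) (at s within ?S)"
    proof (rule has_derivative_series[where f = I and l = "\<Sum>n. I n t"])
      show "t \<in> ?S" "(\<lambda>n. I n t) sums (\<Sum>n. I n t)"
        using tS summable_sums[OF summI] by auto
      show "(I n has_derivative (\<lambda>h. h *\<^sub>R D n s)) (at s within ?S)" for n s
        using D[of n s] has_vector_derivative_at_within unfolding has_vector_derivative_def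
        by (blast intro: has_derivative_at_withinI)
      fix e :: real assume "0 < e"
      then have "\<forall>\<^sub>F n in sequentially. \<forall>s\<in>?S. norm ((\<Sum>i<n. D i s) - prod (A s) (\<Sum>n. I n s)) < e"
        using unif by (auto simp: uniform_limit_iff dist_norm)
      then show "\<forall>\<^sub>F n in sequentially. \<forall>s\<in>?S. \<forall>h.
          norm ((\<Sum>i<n. h *\<^sub>R D i s) - h *\<^sub>R prod (A s) (\<Sum>n. I n s)) \<le> e * norm h"
      proof eventually_elim
        case (elim n)
        show ?case
        proof (intro ballI allI)
          fix s h assume "s \<in> ?S"
          have "norm ((\<Sum>i<n. h *\<^sub>R D i s) - h *\<^sub>R prod (A s) (\<Sum>n. I n s))
              = \<bar>h\<bar> * norm ((\<Sum>i<n. D i s) - prod (A s) (\<Sum>n. I n s))"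
            by (simp add: scaleR_sum_right[symmetric] scaleR_diff_right[symmetric] del: scaleR_diff_right)
          also have "\<dots> \<le> \<bar>h\<bar> * e"
            using elim \<open>s \<in> ?S\<close> by (intro mult_left_mono) (auto intro: less_imp_le)
          finally show "norm ((\<Sum>i<n. h *\<^sub>R D i s) - h *\<^sub>R prod (A s) (\<Sum>n. I n s)) \<le> e * norm h"
            by (simp add: mult.commute)
        qed
      qed
    qed simp
    then obtain g where g: "\<And>s. s \<in> ?S \<Longrightarrow> (\<lambda>n. I n s) sums g s"
      "\<And>s. s \<in> ?S \<Longrightarrow> (g has_vector_derivative prod (A s) (\<Sum>n. I n s)) (at s within ?S)"
      unfolding has_vector_derivative_def by blast
    have "(g has_vector_derivative prod (A t) (\<Sum>n. I n t)) (at t)"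
      using g(2)[OF tS] tS by (metis at_within_open open_greaterThanLessThan)
    then have "((\<lambda>s. \<Sum>n. I n s) has_vector_derivative prod (A t) (\<Sum>n. I n t)) (at t)"
      by (rule has_vector_derivative_transform_within_open[of _ _ _ ?S])
        (use tS g(1) sums_unique in auto)
    with summable_sums[OF summI[OF tS]] show ?thesis by blast
  qed
  show thesis
  proof
    show "((\<lambda>s. \<Sum>n. I n s) has_vector_derivative prod (A t) (\<Sum>n. I n t)) (at t)" for t
      using main[of t "\<bar>t\<bar> + 1"] by simp
    have "(\<lambda>n. I n 0) sums x0"
      using sums_single[of 0 "\<lambda>_. x0"] 
      by (rule sums_cong[THEN iffD1, rotated]) (metis I0 ISuc0 not0_implies_Suc)
    then show "(\<Sum>n. I n 0) = x0" by (simp add: sums_iff)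
  qed
qed

text \<open>The defect \<open>I - U V\<close> is idempotent because \<open>V U = I\<close>, and a nonzero idempotent has norm
  at least 1; as the defect depends continuously on \<open>t\<close> and vanishes at \<open>0\<close>, it vanishes
  identically. This replaces the uniqueness theorem for the equation of \<open>U V\<close>.\<close>

lemma left_inverse_curve_is_right_inverse:
  fixes U V :: "real \<Rightarrow> 'a \<Rightarrow>\<^sub>L 'a::real_normed_vector"
  assumes VU: "\<And>t. V t o\<^sub>L U t = id_blinfun"
    and U: "continuous_on UNIV U" and V: "continuous_on UNIV V"
    and UV0: "U 0 o\<^sub>L V 0 = id_blinfun"
  shows "U t o\<^sub>L V t = id_blinfun"
proof -
  define E where "E t = id_blinfun - (U t o\<^sub>L V t)" for t
  have VUx: "V t (U t x) = x" for t x
    using VU[of t] by (metis blinfun_apply_blinfun_compose blinfun_apply_id_blinfun)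
  have EE: "E t o\<^sub>L E t = E t" for t
    by (rule blinfun_eqI) (simp add: E_def blinfun.bilinear_simps VUx)
  have gap: "norm (E t) = 0 \<or> 1 \<le> norm (E t)" for t
    using norm_blinfun_compose[of "E t" "E t"] by (auto simp: EE mult_le_cancel_left1)
  have cont: "continuous_on UNIV (\<lambda>t. norm (E t))"
    unfolding E_def
    by (intro continuous_intros bounded_bilinear.continuous_on[OF bounded_bilinear_blinfun_compose] U V)
  then have conn: "connected (range (\<lambda>t. norm (E t)))"
    by (intro connected_continuous_image) auto
  have E0: "norm (E 0) = 0"
    by (simp add: E_def UV0)
  have "\<not> 1 \<le> norm (E t)"
  proof
    assume "1 \<le> norm (E t)"
    then have "1/2 \<in> range (\<lambda>t. norm (E t))"
      using connectedD_interval[OF conn, of "norm (E 0)" "norm (E t)" "1/2"] E0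
      by auto
    then obtain s where "norm (E s) = 1/2" by (metis imageE)
    with gap[of s] show False by auto
  qed
  with gap[of t] have "norm (E t) = 0" by blast
  then show ?thesis by (simp add: E_def)
qed

text \<open>\<open>V\<close> solves the adjoint equation, so \<open>V t (W t x)\<close> is constant
  in \<open>t\<close> for every candidate \<open>W\<close> for the Cauchy operator. Hence
  \<open>V\<close> is a left inverse of each candidate; once it is also a right inverse of
  \<open>U\<close>, all candidates coincide with \<open>U\<close>, and both definite descriptions
  are justified.\<close>

lemma cauchy_operator_exists:
  fixes A :: "real \<Rightarrow> 'a \<Rightarrow>\<^sub>L 'a::banach"
  assumes A: "continuous_on UNIV A"
  obtains V where "cauchy_operator A 0 = id_blinfun"
    and "\<And>t. (cauchy_operator A has_vector_derivative A t o\<^sub>L cauchy_operator A t) (at t)"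
    and "\<And>t. (V has_vector_derivative - (V t o\<^sub>L A t)) (at t)"
    and "\<And>t. V t o\<^sub>L cauchy_operator A t = id_blinfun"
    and "\<And>t. cauchy_operator A t o\<^sub>L V t = id_blinfun"
    and "\<And>t. blinfun_inverse (cauchy_operator A t) = V t"
proof -
  \<comment> \<open>The sign and the reversed order of composition bring the adjoint equation into
    the form treated by the existence lemma.\<close>
  have bb: "bounded_bilinear (\<lambda>a X :: 'a \<Rightarrow>\<^sub>L 'a. - (X o\<^sub>L a))"
    by unfold_locales
      (auto intro!: blinfun_eqI exI[where x = 1] norm_blinfun_compose
        simp: blinfun.bilinear_simps mult.commute)
  obtain U where U0: "U 0 = id_blinfun"
    and U: "\<And>t. (U has_vector_derivative A t o\<^sub>L U t) (at t)"
    using bilinear_ode_solution_exists[OF bounded_bilinear_blinfun_compose A, of id_blinfun] by metis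
  obtain V where V0: "V 0 = id_blinfun"
    and V: "\<And>t. (V has_vector_derivative - (V t o\<^sub>L A t)) (at t)"
    using bilinear_ode_solution_exists[OF bb A, of id_blinfun] by metis
  have cont: "continuous_on UNIV U" "continuous_on UNIV V"
    using U V by (meson continuous_at_imp_continuous_on has_vector_derivative_continuous)+
  \<comment> \<open>By the product rule the derivative is \<open>- V A W x + V A W x = 0\<close>,
    and the value at \<open>0\<close> is \<open>x\<close>.\<close>
  have VUx: "V t (W t x) = x"
    if "W 0 = id_blinfun" "\<And>x. linear_ode_solution A (\<lambda>t. 0) (\<lambda>t. W t x)" for W t x
  proof -
    have "((\<lambda>t. V t (W t x)) has_vector_derivative 0) (at t)" for t
      using bounded_bilinear.has_vector_derivative[OF bounded_bilinear_blinfun_apply V[of t],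
          of "\<lambda>t. W t x" "A t (W t x)"] that(2)[of x]
      by (simp add: linear_ode_solution_def blinfun.bilinear_simps)
    then obtain c where "\<And>t. V t (W t x) = c"
      using has_vector_derivative_zero_constant[of UNIV "\<lambda>t. V t (W t x)"] by auto
    from this[of t] this[of 0] show ?thesis by (simp add: V0 that(1))
  qed
  have Usol: "linear_ode_solution A (\<lambda>t. 0) (\<lambda>t. U t x)" for x
    unfolding linear_ode_solution_def
  proof
    fix t
    show "((\<lambda>t. U t x) has_vector_derivative A t (U t x) + 0) (at t)"
      using bounded_linear.has_vector_derivative[OF blinfun.bounded_linear_left[of x] U[of t]]
      by simp
  qed
  have VU: "V t o\<^sub>L U t = id_blinfun" for t
    by (rule blinfun_eqI) (simp add: VUx[OF U0 Usol])
  have UV: "U t o\<^sub>L V t = id_blinfun" for t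
    by (rule left_inverse_curve_is_right_inverse[OF VU cont]) (simp add: U0 V0 blinfun_eqI)
  have "cauchy_operator A = U"
    unfolding cauchy_operator_def
  proof (rule the_equality)
    show "U 0 = id_blinfun \<and> (\<forall>x. linear_ode_solution A (\<lambda>t. 0) (\<lambda>t. U t x))"
      using U0 Usol by blast
    fix W assume W: "W 0 = id_blinfun \<and> (\<forall>x. linear_ode_solution A (\<lambda>t. 0) (\<lambda>t. W t x))"
    show "W = U"
    proof (intro ext blinfun_eqI)
      fix t x
      have "U t (V t (W t x)) = U t x" using VUx[of W t x] W by simp
      moreover have "U t (V t y) = y" for y
        using UV[of t] by (metis blinfun_apply_blinfun_compose blinfun_apply_id_blinfun)
      ultimately show "W t x = U t x" by simp
    qed
  qed
  moreover have "blinfun_inverse (U t) = V t" for t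
    unfolding blinfun_inverse_def
  proof (rule the_equality)
    fix W assume W: "W o\<^sub>L U t = id_blinfun \<and> U t o\<^sub>L W = id_blinfun"
    have "W = W o\<^sub>L (U t o\<^sub>L V t)" by (simp add: UV blinfun_eqI)
    also have "\<dots> = (W o\<^sub>L U t) o\<^sub>L V t" by (simp add: blinfun_eqI)
    also have "\<dots> = V t" using W by (simp add: blinfun_eqI)
    finally show "W = V t" .
  qed (simp add: UV VU)
  ultimately show ?thesis
    using U0 U V VU UV by (intro that[of V]) auto
qed

section \<open>The Green integral\<close>

text \<open>The integral over the line is a limit over intervals containing a large ball about
  \<open>0\<close>. That ball is symmetric, so the same radius works after replacing
  \<open>[a, b]\<close> by \<open>[-b, -a]\<close>.\<close>

lemma has_integral_reflect_UNIV:
  fixes f :: "real \<Rightarrow> 'a::real_normed_vector"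
  assumes "(f has_integral i) UNIV"
  shows "((\<lambda>x. f (- x)) has_integral i) UNIV"
proof -
  have nb: "\<not> (\<exists>a b. (UNIV :: real set) = cbox a b)"
    by (metis bounded_cbox not_bounded_UNIV)
  have "\<exists>B>0. \<forall>a b. ball 0 B \<subseteq> cbox a b \<longrightarrow>
      (\<exists>z. ((\<lambda>x. f (- x)) has_integral z) (cbox a b) \<and> norm (z - i) < e)" if "e > 0" for e
  proof -
    obtain B where B: "B > 0" "\<And>a b. ball 0 B \<subseteq> cbox a b \<Longrightarrow>
        \<exists>z. (f has_integral z) (cbox a b) \<and> norm (z - i) < e"
      using has_integral_altD[OF assms nb \<open>e > 0\<close>] by (auto cong: if_cong)
    show ?thesis
    proof (intro exI[of _ B] conjI allI impI)
      fix a b :: real assume sub: "ball 0 B \<subseteq> cbox a b"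
      have "ball 0 B \<subseteq> cbox (- b) (- a)"
      proof
        fix x :: real assume "x \<in> ball 0 B"
        then have "- x \<in> ball 0 B" by simp
        with sub have "- x \<in> cbox a b" by blast
        then show "x \<in> cbox (- b) (- a)" by auto
      qed
      from B(2)[OF this] obtain z where "(f has_integral z) {- b..- a}" "norm (z - i) < e"
        by auto
      then show "\<exists>z. ((\<lambda>x. f (- x)) has_integral z) (cbox a b) \<and> norm (z - i) < e"
        using has_integral_reflect_lemma_real[of f z "- b" "- a"] by auto
    qed (rule B)
  qed
  then show ?thesis
    using nb by (subst has_integral_alt) auto
qed

text \<open>Each side of \<open>t\<close> contributes \<open>1 / \<nu>\<close>: the right one
  directly, the left one by reflection. The common point \<open>t\<close> is negligible.\<close>

lemma has_integral_exp_minus_abs: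
  fixes \<nu> t :: real
  assumes "0 < \<nu>"
  shows "((\<lambda>s. exp (- \<nu> * \<bar>t - s\<bar>)) has_integral 2 / \<nu>) UNIV"
proof -
  have right: "((\<lambda>s. exp (- \<nu> * \<bar>c - s\<bar>)) has_integral 1 / \<nu>) {c..}" for c
  proof -
    have "((\<lambda>s. exp (\<nu> * c) * exp (- \<nu> * s)) has_integral exp (\<nu> * c) * (exp (- \<nu> * c) / \<nu>)) {c..}"
      by (intro has_integral_mult_right has_integral_exp_minus_to_infinity assms)
    then show ?thesis
      by (rule has_integral_eq_rhs[OF has_integral_eq[rotated]])
        (auto simp: exp_add[symmetric] algebra_simps exp_minus field_simps)
  qed
  have "((\<lambda>s. if s \<in> {- t..} then exp (- \<nu> * \<bar>- t - s\<bar>) else 0) has_integral 1 / \<nu>) UNIV"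
    using right[of "- t"] by (simp only: has_integral_restrict_UNIV)
  from has_integral_reflect_UNIV[OF this]
  have "((\<lambda>s. if s \<in> {..t} then exp (- \<nu> * \<bar>t - s\<bar>) else 0) has_integral 1 / \<nu>) UNIV"
    by (rule has_integral_eq[rotated]) (auto simp: abs_minus_commute)
  then have left: "((\<lambda>s. exp (- \<nu> * \<bar>t - s\<bar>)) has_integral 1 / \<nu>) {..t}"
    by (simp only: has_integral_restrict_UNIV)
  from has_integral_Un[OF left right[of t]]
  have "((\<lambda>s. exp (- \<nu> * \<bar>t - s\<bar>)) has_integral 1 / \<nu> + 1 / \<nu>) ({..t} \<union> {t..})"
    by (simp add: ivl_disj_un Int_commute[of "{..t}"] atLeastAtMost_def[symmetric])
  moreover have "{..t} \<union> {t..} = UNIV" by auto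
  ultimately show ?thesis by simp
qed

text \<open>Each branch of the Green function fixes the sign of \<open>t - \<tau>\<close>, so the
  four trichotomy estimates merge into one kernel.\<close>

lemma norm_green_function_le:
  assumes "exponential_trichotomy_with A P Q"
  shows "\<exists>N \<nu>. N \<ge> 1 \<and> \<nu> > 0 \<and>
    (\<forall>t \<tau>. norm (green_function A P Q t \<tau>) \<le> N * exp (- \<nu> * \<bar>t - \<tau>\<bar>))"
proof -
  obtain N \<nu> where N: "N \<ge> 1" "\<nu> > 0"
    and bounds: "\<forall>t \<tau>. 0 \<le> \<tau> \<and> \<tau> \<le> t \<longrightarrow> norm (evolution A P t \<tau>) \<le> N * exp (- \<nu> * (t - \<tau>))"
    "\<forall>t \<tau>. t \<le> \<tau> \<and> 0 \<le> \<tau> \<longrightarrow>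
      norm (evolution A (id_blinfun - P) t \<tau>) \<le> N * exp (- \<nu> * (\<tau> - t))"
    "\<forall>t \<tau>. t \<le> \<tau> \<and> \<tau> \<le> 0 \<longrightarrow> norm (evolution A Q t \<tau>) \<le> N * exp (- \<nu> * (\<tau> - t))"
    "\<forall>t \<tau>. \<tau> \<le> t \<and> \<tau> \<le> 0 \<longrightarrow>
      norm (evolution A (id_blinfun - Q) t \<tau>) \<le> N * exp (- \<nu> * (t - \<tau>))"
    using assms unfolding exponential_trichotomy_with_def by (elim conjE exE) (rule that; assumption)
  have "norm (green_function A P Q t \<tau>) \<le> N * exp (- \<nu> * \<bar>t - \<tau>\<bar>)" for t \<tau>
    using bounds[THEN spec, of t, THEN spec, of \<tau>]
    by (auto simp: green_function_def abs_if)
  with N show ?thesis by blast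
qed

text \<open>The exponential kernel and the bound on \<open>f\<close> dominate the integrand, which
  gives existence of the integral and a bound uniform in \<open>t\<close>. The dependence on
  \<open>t\<close> is moved into \<open>U t\<close> and an antiderivative, so the equation follows
  without differentiating under the integral sign.\<close>

lemma green_integral_solution:
  fixes A :: "real \<Rightarrow> ('a::banach \<Rightarrow>\<^sub>L 'a)" and f :: "real \<Rightarrow> 'a"
  assumes A: "continuous_on UNIV A" and f: "continuous_on UNIV f" and bdd: "bounded (range f)"
    and tri: "exponential_trichotomy_with A P Q"
  shows "\<exists>\<phi>. linear_ode_solution A f \<phi> \<and> bounded (range \<phi>) \<and>
    (\<forall>t. ((\<lambda>\<tau>. green_function A P Q t \<tau> (f \<tau>)) has_integral \<phi> t) UNIV)"
proof -
  define U where "U = cauchy_operator A"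
  obtain V where U0: "U 0 = id_blinfun"
    and U: "\<And>t. (U has_vector_derivative A t o\<^sub>L U t) (at t)"
    and V: "\<And>t. (V has_vector_derivative - (V t o\<^sub>L A t)) (at t)"
    and UV: "\<And>t. U t o\<^sub>L V t = id_blinfun"
    and inv: "\<And>t. blinfun_inverse (U t) = V t"
    using cauchy_operator_exists[OF A] unfolding U_def by metis
  have ev: "evolution A R t s = U t o\<^sub>L R o\<^sub>L V s" for R t s
    by (simp add: evolution_def inv U_def[symmetric])
  obtain N \<nu> where N: "N \<ge> 1" "\<nu> > 0"
    and G: "\<And>t \<tau>. norm (green_function A P Q t \<tau>) \<le> N * exp (- \<nu> * \<bar>t - \<tau>\<bar>)"
    using norm_green_function_le[OF tri] by blast
  obtain F where F: "\<And>t. norm (f t) \<le> F" "F > 0"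
    using bdd unfolding bounded_pos by auto
  have GF: "norm (green_function A P Q t \<tau> (f \<tau>)) \<le> N * F * exp (- \<nu> * \<bar>t - \<tau>\<bar>)" for t \<tau>
  proof -
    have "norm (green_function A P Q t \<tau> (f \<tau>)) \<le> norm (green_function A P Q t \<tau>) * norm (f \<tau>)"
      by (rule norm_blinfun)
    also have "\<dots> \<le> (N * exp (- \<nu> * \<bar>t - \<tau>\<bar>)) * F"
      using N by (intro mult_mono G F) auto
    finally show ?thesis by (simp add: mult_ac)
  qed
  \<comment> \<open>The forcing term pulled back to time \<open>0\<close>, as in variation of
    constants.\<close>
  define p where "p s = V s (f s)" for s
  have contV: "continuous_on UNIV V"
    using V by (meson continuous_at_imp_continuous_on has_vector_derivative_continuous)
  have p: "continuous_on UNIV p"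
    unfolding p_def by (intro bounded_bilinear.continuous_on[OF bounded_bilinear_blinfun_apply] contV f)
  have dominated: "((\<lambda>s. N * F * exp (- \<nu> * \<bar>t - s\<bar>)) has_integral N * F * (2 / \<nu>)) UNIV" for t
    by (intro has_integral_mult_right has_integral_exp_minus_abs N)
  \<comment> \<open>Up to sign the integrand is the Green integrand at \<open>t = 0\<close>, hence
    dominated by the kernel centred at \<open>0\<close>; the point \<open>0\<close>, where branches
    overlap, is removed. \<open>S\<close> will be a closed half line, which meets each box in an
    interval, so continuity of \<open>p\<close> gives local integrability.\<close>
  have integrable: "(\<lambda>s. if s \<in> S then R (p s) else 0) integrable_on UNIV"
    if S: "\<And>a b. \<exists>c d. S \<inter> cbox a b = {c..d}"
      and le: "\<And>s. s \<in> S - {0} \<Longrightarrow>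
        R (p s) = green_function A P Q 0 s (f s) \<or> R (p s) = - green_function A P Q 0 s (f s)"
    for S and R :: "'a \<Rightarrow>\<^sub>L 'a"
  proof (rule integrable_spike_finite[of "{0}"])
    show "(\<lambda>s. if s \<in> S - {0} then R (p s) else 0) integrable_on UNIV"
    proof (rule integrable_on_all_intervals_integrable_bound)
      show "(\<lambda>s. N * F * exp (- \<nu> * \<bar>0 - s\<bar>)) integrable_on UNIV"
        using dominated by (rule has_integral_integrable)
      show "norm (if s \<in> S - {0} then R (p s) else 0) \<le> N * F * exp (- \<nu> * \<bar>0 - s\<bar>)" for s
        using GF[of 0 s] le[of s] N F by auto
      show "(\<lambda>s. if s \<in> UNIV then if s \<in> S - {0} then R (p s) else 0 else 0) integrable_on cbox a b"
        for a b :: real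
      proof -
        obtain c d where "S \<inter> cbox a b = {c..d}" using S by metis
        moreover have "(\<lambda>s. R (p s)) integrable_on {c..d}"
          by (intro integrable_continuous_real continuous_intros continuous_on_subset[OF p]) auto
        ultimately have "(\<lambda>s. if s \<in> S then R (p s) else 0) integrable_on cbox a b"
          by (simp add: integrable_restrict_Int)
        then show ?thesis
          by (rule integrable_spike_finite[of "{0}", rotated -1]) auto
      qed
    qed
  qed auto
  have "(\<lambda>s. if s \<in> {..0} then (id_blinfun - Q) (p s) else 0) integrable_on UNIV"
  proof (rule integrable)
    show "\<exists>c d. {..0} \<inter> cbox a b = {c..d}" for a b :: real
      by (intro exI[of _ a] exI[of _ "min 0 b"]) auto
  qed (auto simp: green_function_def ev U0 p_def)
  then obtain a where a: "((\<lambda>s. if s \<in> {..0} then (id_blinfun - Q) (p s) else 0) has_integral a) UNIV"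
    by blast
  have "(\<lambda>s. if s \<in> {0..} then (id_blinfun - P) (p s) else 0) integrable_on UNIV"
  proof (rule integrable)
    show "\<exists>c d. {0..} \<inter> cbox a b = {c..d}" for a b :: real
      by (intro exI[of _ "max 0 a"] exI[of _ b]) auto
  qed (auto simp: green_function_def ev U0 p_def blinfun.bilinear_simps)
  then obtain b where b: "((\<lambda>s. if s \<in> {0..} then (id_blinfun - P) (p s) else 0) has_integral b) UNIV"
    by blast
  obtain c where c: "c 0 = 0" "\<And>t. (c has_vector_derivative p t) (at t)"
    using has_antiderivative_UNIV[OF p] by metis
  \<comment> \<open>The oriented integral of \<open>p\<close> from \<open>0\<close> to
    \<open>t\<close>, written over the whole line so that it can be added to \<open>a\<close> and
    \<open>b\<close>.\<close>
  have c_int: "((\<lambda>s. (if s \<in> {0..t} then p s else 0) - (if s \<in> {t..0} then p s else 0)) has_integral c t) UNIV" for t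
  proof -
    have ftc: "((\<lambda>s. if s \<in> {u..v} then p s else 0) has_integral c v - c u) UNIV" if "u \<le> v" for u v
      unfolding has_integral_restrict_UNIV
      using that c(2) by (intro fundamental_theorem_of_calculus) (auto intro: has_vector_derivative_at_within)
    consider "t = 0" | "t < 0" | "0 < t" by linarith
    then show ?thesis
    proof cases
      case 2
      then show ?thesis using has_integral_neg[OF ftc[of t 0]] c(1)
        by (auto cong: if_cong)
    next
      case 3
      then show ?thesis using ftc[of 0 t] c(1)
        by (auto cong: if_cong)
    qed (simp add: c(1))
  qed
  \<comment> \<open>Pulled back by \<open>U t\<close>, the Green function is \<open>I - Q\<close> for \<open>s < 0\<close> and \<open>-(I - P)\<close> for \<open>s > 0\<close>,
    independently of \<open>t\<close>, plus \<open>\<plusminus>I\<close> between \<open>0\<close> and \<open>t\<close>; hence its integral is this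
    variation-of-constants formula.\<close>
  define \<phi> where "\<phi> t = U t (a - b + c t)" for t
  have int: "((\<lambda>s. green_function A P Q t s (f s)) has_integral \<phi> t) UNIV" for t
  proof -
    have "((\<lambda>s. U t ((if s \<in> {..0} then (id_blinfun - Q) (p s) else 0)
        - (if s \<in> {0..} then (id_blinfun - P) (p s) else 0)
        + ((if s \<in> {0..t} then p s else 0) - (if s \<in> {t..0} then p s else 0)))) has_integral \<phi> t) UNIV"
      unfolding \<phi>_def
      using has_integral_linear[OF has_integral_add[OF has_integral_diff[OF a b] c_int[of t]]
          blinfun.bounded_linear_right[of "U t"]]
      by (simp add: o_def)
    then show ?thesis
    proof (rule has_integral_spike_finite[of "{0, t}", rotated -1])
      fix s assume "s \<in> UNIV - {0, t}"
      then show "green_function A P Q t s (f s) =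
        U t ((if s \<in> {..0} then (id_blinfun - Q) (p s) else 0)
        - (if s \<in> {0..} then (id_blinfun - P) (p s) else 0)
        + ((if s \<in> {0..t} then p s else 0) - (if s \<in> {t..0} then p s else 0)))"
        by (auto simp: green_function_def ev p_def blinfun.bilinear_simps)
    qed simp
  qed
  have "linear_ode_solution A f \<phi>"
    unfolding linear_ode_solution_def
  proof
    fix t
    have "((\<lambda>t. a - b + c t) has_vector_derivative 0 + p t) (at t)"
      by (intro has_vector_derivative_add has_vector_derivative_const c)
    from bounded_bilinear.has_vector_derivative[OF bounded_bilinear_blinfun_apply U[of t] this]
    have "(\<phi> has_vector_derivative U t (p t) + A t (\<phi> t)) (at t)"
      by (simp add: \<phi>_def[abs_def])
    moreover have "U t (p t) = f t"
      unfolding p_def using UV[of t] by (metis blinfun_apply_blinfun_compose blinfun_apply_id_blinfun)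
    ultimately show "(\<phi> has_vector_derivative A t (\<phi> t) + f t) (at t)"
      by (simp add: add.commute)
  qed
  moreover have "norm (\<phi> t) \<le> N * F * (2 / \<nu>)" for t
    using integral_norm_bound_integral[OF has_integral_integrable[OF int[of t]]
        has_integral_integrable[OF dominated[of t]] GF]
    by (simp only: integral_unique[OF int] integral_unique[OF dominated])
  then have "bounded (range \<phi>)" unfolding bounded_iff by blast
  ultimately show ?thesis using int by blast
qed

section \<open>Remote behaviour of bounded solutions\<close>

text \<open>The \<open>P\<close> component is integrated forward from \<open>T\<close>, the
  complementary one backward from a far time \<open>b\<close>, where boundedness of \<open>y\<close>
  makes the endpoint term vanish as \<open>b\<close> tends to infinity. \<open>U\<close> and
  \<open>V\<close> are kept abstract so that the time-reflected system can be inserted as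
  well.\<close>

lemma bounded_solution_half_line_bound:
  fixes U V :: "real \<Rightarrow> 'a \<Rightarrow>\<^sub>L 'a::real_normed_vector" and y h :: "real \<Rightarrow> 'a"
  assumes UV: "\<And>t. U t o\<^sub>L V t = id_blinfun"
    and deriv: "\<And>t. ((\<lambda>t. V t (y t)) has_vector_derivative V t (h t)) (at t)"
    and N: "0 \<le> N" and \<nu>: "0 < \<nu>"
    and stable: "\<And>t \<tau>. 0 \<le> \<tau> \<Longrightarrow> \<tau> \<le> t \<Longrightarrow> norm (U t o\<^sub>L P o\<^sub>L V \<tau>) \<le> N * exp (- \<nu> * (t - \<tau>))"
    and unstable: "\<And>t \<tau>. 0 \<le> t \<Longrightarrow> t \<le> \<tau> \<Longrightarrow>
      norm (U t o\<^sub>L (id_blinfun - P) o\<^sub>L V \<tau>) \<le> N * exp (- \<nu> * (\<tau> - t))"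
    and y: "\<And>t. norm (y t) \<le> M"
    and h: "\<And>t. T \<le> t \<Longrightarrow> norm (h t) \<le> \<eta>" and T: "0 \<le> T" "T \<le> t"
  shows "norm (y t) \<le> N * M * exp (- \<nu> * (t - T)) + 2 * N * \<eta> / \<nu>"
proof -
  have M: "0 \<le> M" using y[of 0] norm_ge_zero order_trans by blast
  have \<eta>: "0 \<le> \<eta>" using h[of T] norm_ge_zero order_trans by blast
  \<comment> \<open>For fixed \<open>t\<close> the derivative in \<open>s\<close> of
    \<open>U t (R (V s (y s)))\<close> involves only \<open>h\<close>. The mean value inequality
    against a scalar antiderivative \<open>\<phi>\<close> of the bound takes the place of a vector
    integral.\<close>
  have inc: "norm (U t (R (V b (y b))) - U t (R (V a (y a)))) \<le> \<phi> b - \<phi> a"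
    if ab: "a \<le> b" and phi: "\<And>s. (\<phi> has_vector_derivative N * e s * \<eta>) (at s)"
      and e: "\<And>s. a \<le> s \<Longrightarrow> s \<le> b \<Longrightarrow> norm (U t o\<^sub>L R o\<^sub>L V s) \<le> N * e s"
      and a: "T \<le> a"
    for R :: "'a \<Rightarrow>\<^sub>L 'a" and a b \<phi> e
  proof (cases "a = b")
    case False
    have d: "((\<lambda>s. U t (R (V s (y s)))) has_vector_derivative U t (R (V s (h s)))) (at s)" for s
      using bounded_linear.has_vector_derivative[OF blinfun.bounded_linear_right[of "U t o\<^sub>L R"] deriv]
      by simp
    show ?thesis
    proof (rule differentiable_bound_general)
      show "a < b" using ab False by simp
      show "continuous_on {a..b} \<phi>" "continuous_on {a..b} (\<lambda>s. U t (R (V s (y s))))"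
        using d phi by (meson continuous_at_imp_continuous_on has_vector_derivative_continuous)+
      fix s assume s: "a < s" "s < b"
      have "norm (U t (R (V s (h s)))) \<le> norm (U t o\<^sub>L R o\<^sub>L V s) * norm (h s)"
        using norm_blinfun[of "U t o\<^sub>L R o\<^sub>L V s" "h s"] by simp
      also have "\<dots> \<le> N * e s * \<eta>"
        using s a \<eta> order_trans[OF norm_ge_zero e[of s]]
        by (intro mult_mono e h) auto
      finally show "norm (U t (R (V s (h s)))) \<le> N * e s * \<eta>" .
    qed (use d phi in auto)
  qed simp
  have endpoint: "norm (U t (R (V s (y s)))) \<le> c * M" if "norm (U t o\<^sub>L R o\<^sub>L V s) \<le> c" for R s c
  proof -
    have "norm (U t (R (V s (y s)))) \<le> norm (U t o\<^sub>L R o\<^sub>L V s) * norm (y s)"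
      using norm_blinfun[of "U t o\<^sub>L R o\<^sub>L V s" "y s"] by simp
    also have "\<dots> \<le> c * M"
      using order_trans[OF norm_ge_zero that] by (intro mult_mono that y) auto
    finally show ?thesis .
  qed
  have stable_part: "norm (U t (P (V t (y t)))) \<le> N * M * exp (- \<nu> * (t - T)) + N * \<eta> / \<nu>"
  proof -
    \<comment> \<open>The antiderivative of the bound contributes \<open>N * \<eta> / \<nu>\<close>
      at \<open>t\<close>; its value at \<open>T\<close> enters negatively and is dropped. The
      endpoint \<open>T\<close> itself leaves the decaying transient.\<close>
    have "norm (U t (P (V t (y t))) - U t (P (V T (y T))))
        \<le> N * \<eta> / \<nu> * exp (- \<nu> * (t - t)) - N * \<eta> / \<nu> * exp (- \<nu> * (t - T))"
    proof (rule inc[where e = "\<lambda>s. exp (- \<nu> * (t - s))"])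
      show "((\<lambda>s. N * \<eta> / \<nu> * exp (- \<nu> * (t - s))) has_vector_derivative
          N * exp (- \<nu> * (t - s)) * \<eta>) (at s)" for s
        unfolding has_real_derivative_iff_has_vector_derivative[symmetric]
        using \<nu> by (auto intro!: derivative_eq_intros)
      fix s assume "T \<le> s" "s \<le> t"
      then show "norm (U t o\<^sub>L P o\<^sub>L V s) \<le> N * exp (- \<nu> * (t - s))"
        using T by (intro stable) auto
    qed (use T in auto)
    moreover have "norm (U t (P (V T (y T)))) \<le> N * exp (- \<nu> * (t - T)) * M"
      by (intro endpoint stable T)
    moreover have "0 \<le> N * \<eta> / \<nu> * exp (- \<nu> * (t - T))"
      using N \<eta> \<nu> by simp
    ultimately show ?thesis
      using norm_triangle_sub[of "U t (P (V t (y t)))" "U t (P (V T (y T)))"]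
      by (simp add: mult_ac)
  qed
  let ?R = "id_blinfun - P"
  have unstable_part: "norm (U t (?R (V t (y t)))) \<le> N * \<eta> / \<nu>"
  proof -
    have le: "norm (U t (?R (V t (y t)))) \<le> N * \<eta> / \<nu> + N * M * exp (- \<nu> * (b - t))" if "t \<le> b" for b
    proof -
      have "norm (U t (?R (V b (y b))) - U t (?R (V t (y t))))
          \<le> (- N * \<eta> / \<nu>) * exp (- \<nu> * (b - t)) - (- N * \<eta> / \<nu>) * exp (- \<nu> * (t - t))"
      proof (rule inc[where e = "\<lambda>s. exp (- \<nu> * (s - t))"])
        show "((\<lambda>s. - N * \<eta> / \<nu> * exp (- \<nu> * (s - t))) has_vector_derivative
            N * exp (- \<nu> * (s - t)) * \<eta>) (at s)" for s
          unfolding has_real_derivative_iff_has_vector_derivative[symmetric]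
          using \<nu> by (auto intro!: derivative_eq_intros)
        fix s assume "t \<le> s" "s \<le> b"
        then show "norm (U t o\<^sub>L ?R o\<^sub>L V s) \<le> N * exp (- \<nu> * (s - t))"
          using T by (intro unstable) auto
      qed (use T that in auto)
      moreover have "norm (U t (?R (V b (y b)))) \<le> N * exp (- \<nu> * (b - t)) * M"
        using T that by (intro endpoint unstable) auto
      moreover have "0 \<le> N * \<eta> / \<nu> * exp (- \<nu> * (b - t))"
        using N \<eta> \<nu> by simp
      ultimately show ?thesis
        using norm_triangle_sub[of "U t (?R (V t (y t)))" "U t (?R (V b (y b)))"]
        by (simp add: mult_ac norm_minus_commute)
    qed
    \<comment> \<open>The left side of \<open>le\<close> does not depend on \<open>b\<close>, so
      letting \<open>b\<close> tend to infinity removes the endpoint term.\<close>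
    have "((\<lambda>b. exp (- \<nu> * (b - t))) \<longlongrightarrow> 0) at_top"
      using \<nu> by real_asymp
    then have "((\<lambda>b. N * \<eta> / \<nu> + N * M * exp (- \<nu> * (b - t))) \<longlongrightarrow> N * \<eta> / \<nu> + N * M * 0) at_top"
      by (intro tendsto_intros)
    then have "norm (U t (?R (V t (y t)))) \<le> N * \<eta> / \<nu> + N * M * 0"
      by (rule tendsto_lowerbound)
        (use le in \<open>auto intro: eventually_mono[OF eventually_ge_at_top[of t]]\<close>)
    then show ?thesis by simp
  qed
  have "U t (V t (y t)) = y t"
    using UV[of t] by (metis blinfun_apply_blinfun_compose blinfun_apply_id_blinfun)
  then have "y t = U t (P (V t (y t))) + U t (?R (V t (y t)))"
    by (simp add: blinfun.bilinear_simps)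
  then have "norm (y t) \<le> norm (U t (P (V t (y t)))) + norm (U t (?R (V t (y t))))"
    using norm_triangle_ineq by metis
  with stable_part unstable_part show ?thesis by simp
qed

section \<open>Differences of a bounded solution and its shifts\<close>

lemma linear_ode_solution_continuous:
  "linear_ode_solution A f x \<Longrightarrow> continuous_on UNIV x"
  unfolding linear_ode_solution_def
  by (meson continuous_at_imp_continuous_on has_vector_derivative_continuous)

text \<open>The order of quantifiers matters: \<open>C\<close> is chosen before \<open>s\<close>,
  \<open>\<epsilon>\<close> and \<open>L\<close>, so it serves all shifts in a relatively dense set
  simultaneously.\<close>

lemma bounded_solution_shift_difference:
  fixes A :: "real \<Rightarrow> ('a::banach \<Rightarrow>\<^sub>L 'a)" and f x :: "real \<Rightarrow> 'a"
  assumes A: "continuous_on UNIV A" and tri: "exponential_trichotomy_with A P Q"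
    and sol: "linear_ode_solution A f x" and bdd: "bounded (range x)"
  shows "\<exists>C>0. \<forall>s \<epsilon> L. \<epsilon> > 0 \<longrightarrow>
      (\<forall>t. L \<le> \<bar>t\<bar> \<longrightarrow> dist (A (t + s), f (t + s)) (A t, f t) < \<epsilon>) \<longrightarrow>
      (\<exists>L'>0. \<forall>t. L' \<le> \<bar>t\<bar> \<longrightarrow> dist (x (t + s)) (x t) < C * \<epsilon>)"
proof -
  define U where "U = cauchy_operator A"
  obtain V where V: "\<And>t. (V has_vector_derivative - (V t o\<^sub>L A t)) (at t)"
    and UV: "\<And>t. U t o\<^sub>L V t = id_blinfun"
    and inv: "\<And>t. blinfun_inverse (U t) = V t"
    using cauchy_operator_exists[OF A] unfolding U_def by metis
  have ev: "evolution A R t s = U t o\<^sub>L R o\<^sub>L V s" for R t s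
    by (simp add: evolution_def inv U_def[symmetric])
  obtain N \<nu> where N: "N \<ge> 1" "\<nu> > 0"
    and bounds: "\<forall>t \<tau>. 0 \<le> \<tau> \<and> \<tau> \<le> t \<longrightarrow> norm (U t o\<^sub>L P o\<^sub>L V \<tau>) \<le> N * exp (- \<nu> * (t - \<tau>))"
    "\<forall>t \<tau>. t \<le> \<tau> \<and> 0 \<le> \<tau> \<longrightarrow>
      norm (U t o\<^sub>L (id_blinfun - P) o\<^sub>L V \<tau>) \<le> N * exp (- \<nu> * (\<tau> - t))"
    "\<forall>t \<tau>. t \<le> \<tau> \<and> \<tau> \<le> 0 \<longrightarrow> norm (U t o\<^sub>L Q o\<^sub>L V \<tau>) \<le> N * exp (- \<nu> * (\<tau> - t))"
    "\<forall>t \<tau>. \<tau> \<le> t \<and> \<tau> \<le> 0 \<longrightarrow>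
      norm (U t o\<^sub>L (id_blinfun - Q) o\<^sub>L V \<tau>) \<le> N * exp (- \<nu> * (t - \<tau>))"
    using tri unfolding exponential_trichotomy_with_def ev
    by (elim conjE exE) (rule that; assumption)
  obtain M where M: "M > 0" "\<And>t. norm (x t) \<le> M"
    using bdd unfolding bounded_pos by auto
  \<comment> \<open>The factor \<open>M + 1\<close> comes from the bound on \<open>h\<close>. Of the
    three multiples of \<open>N / \<nu>\<close>, two come from the stable and unstable parts and one
    absorbs the transient.\<close>
  define C where "C = 3 * N * (M + 1) / \<nu>"
  show ?thesis
  proof (rule exI[of _ C], intro conjI allI impI)
    show "C > 0" using M N by (simp add: C_def)
  next
    fix s \<epsilon> L :: real
    assume \<epsilon>: "\<epsilon> > 0"
      and close: "\<forall>t. L \<le> \<bar>t\<bar> \<longrightarrow> dist (A (t + s), f (t + s)) (A t, f t) < \<epsilon>"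
    define y where "y t = x (t + s) - x t" for t
    \<comment> \<open>The coefficient difference acts on \<open>x (t + s)\<close>, which leaves
      \<open>A t\<close> acting on \<open>y t\<close> in the equation for \<open>y\<close>.\<close>
    define h where "h t = (A (t + s) - A t) (x (t + s)) + (f (t + s) - f t)" for t
    define T where "T = max 0 L"
    let ?\<eta> = "\<epsilon> * (M + 1)"
    have y': "(y has_vector_derivative A t (y t) + h t) (at t)" for t
    proof -
      have "((\<lambda>u. x (u + s)) has_vector_derivative A (t + s) (x (t + s)) + f (t + s)) (at t)"
        using vector_diff_chain_at[of "\<lambda>u. u + s" 1 t x] sol
        by (simp add: linear_ode_solution_def o_def has_vector_derivative_add_const)
      then have "(y has_vector_derivative
          A (t + s) (x (t + s)) + f (t + s) - (A t (x t) + f t)) (at t)"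
        unfolding y_def using sol
        by (intro has_vector_derivative_diff) (auto simp: linear_ode_solution_def)
      then show ?thesis
        by (rule has_vector_derivative_eq_rhs) (simp add: h_def y_def blinfun.bilinear_simps)
    qed
    have Vy': "((\<lambda>t. V t (y t)) has_vector_derivative V t (h t)) (at t)" for t
      using bounded_bilinear.has_vector_derivative[OF bounded_bilinear_blinfun_apply V[of t] y']
      by (simp add: blinfun.bilinear_simps)
    \<comment> \<open>Reversing time flips the sign of the forcing term; this form feeds the
      half-line estimate on the negative side.\<close>
    have Vy'_reflected: "((\<lambda>t. V (- t) (y (- t))) has_vector_derivative V (- t) (- h (- t))) (at t)" for t
    proof -
      have "(uminus has_vector_derivative - 1) (at t)"
        using has_vector_derivative_minus[OF has_vector_derivative_id[of "at t"]] by simp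
      from vector_diff_chain_at[OF this Vy'] show ?thesis
        by (simp add: o_def blinfun.bilinear_simps)
    qed
    have y: "norm (y t) \<le> 2 * M" for t
      using norm_triangle_ineq4[of "x (t + s)" "x t"] M(2)[of t] M(2)[of "t + s"] by (simp add: y_def)
    \<comment> \<open>The product metric controls both differences: the coefficients contribute at
      most \<open>\<epsilon> * M\<close>, the forcing at most \<open>\<epsilon>\<close>.\<close>
    have h: "norm (h t) \<le> ?\<eta>" if "T \<le> \<bar>t\<bar>" for t
    proof -
      have *: "dist (A (t + s), f (t + s)) (A t, f t) < \<epsilon>"
        using that by (intro close[rule_format]) (simp add: T_def)
      have "norm (A (t + s) - A t) \<le> \<epsilon>" "norm (f (t + s) - f t) \<le> \<epsilon>"
        using dist_fst_le[of "(A (t + s), f (t + s))" "(A t, f t)"]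
          dist_snd_le[of "(A (t + s), f (t + s))" "(A t, f t)"] *
        by (auto simp: dist_norm)
      moreover have "norm ((A (t + s) - A t) (x (t + s))) \<le> norm (A (t + s) - A t) * norm (x (t + s))"
        by (rule norm_blinfun)
      moreover have "norm (A (t + s) - A t) * norm (x (t + s)) \<le> \<epsilon> * M"
        using calculation(1) M \<epsilon> by (intro mult_mono) auto
      ultimately show ?thesis
        using norm_triangle_ineq[of "(A (t + s) - A t) (x (t + s))" "f (t + s) - f t"]
        by (simp add: h_def algebra_simps)
    qed
    have right: "norm (y t) \<le> N * (2 * M) * exp (- \<nu> * (t - T)) + 2 * N * ?\<eta> / \<nu>" if "T \<le> t" for t
      by (rule bounded_solution_half_line_bound[where U = U and V = V and P = P and h = h])
        (use N bounds(1,2) UV Vy' y h that in \<open>auto simp: T_def simp del: mult_minus_left\<close>)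
    \<comment> \<open>After time reversal the bounds on the negative half line become a dichotomy on
      the positive one, with \<open>Q\<close> as its stable projection.\<close>
    have left: "norm (y (- t)) \<le> N * (2 * M) * exp (- \<nu> * (t - T)) + 2 * N * ?\<eta> / \<nu>" if "T \<le> t" for t
    proof (rule bounded_solution_half_line_bound[where U = "\<lambda>t. U (- t)" and V = "\<lambda>t. V (- t)"
          and P = Q and h = "\<lambda>t. - h (- t)" and y = "\<lambda>t. y (- t)"])
      show "norm (U (- t) o\<^sub>L Q o\<^sub>L V (- \<tau>)) \<le> N * exp (- \<nu> * (t - \<tau>))" if "0 \<le> \<tau>" "\<tau> \<le> t" for t \<tau>
        using bounds(3)[THEN spec, of "- t", THEN spec, of "- \<tau>"] that by simp
      show "norm (U (- t) o\<^sub>L (id_blinfun - Q) o\<^sub>L V (- \<tau>)) \<le> N * exp (- \<nu> * (\<tau> - t))"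
        if "0 \<le> t" "t \<le> \<tau>" for t \<tau>
        using bounds(4)[THEN spec, of "- t", THEN spec, of "- \<tau>"] that by (simp add: algebra_simps)
    qed (use N UV Vy'_reflected y h that in \<open>auto simp: T_def\<close>)
    have "((\<lambda>t. N * (2 * M) * exp (- \<nu> * (t - T))) \<longlongrightarrow> 0) at_top"
      using N(2) by real_asymp
    moreover have "0 < N * ?\<eta> / \<nu>" using N \<epsilon> M by simp
    ultimately have "eventually (\<lambda>t. N * (2 * M) * exp (- \<nu> * (t - T)) < N * ?\<eta> / \<nu>) at_top"
      by (rule order_tendstoD)
    then obtain B where B: "\<And>t. B \<le> t \<Longrightarrow> N * (2 * M) * exp (- \<nu> * (t - T)) < N * ?\<eta> / \<nu>"
      unfolding eventually_at_top_linorder by blast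
    have C\<epsilon>: "C * \<epsilon> = N * ?\<eta> / \<nu> + 2 * N * ?\<eta> / \<nu>"
      by (simp add: C_def add_divide_distrib[symmetric] algebra_simps)
    show "\<exists>L'>0. \<forall>t. L' \<le> \<bar>t\<bar> \<longrightarrow> dist (x (t + s)) (x t) < C * \<epsilon>"
    \<comment> \<open>\<open>1\<close> makes the threshold positive, \<open>T\<close> admits the
      half-line estimates, and beyond \<open>B\<close> the transient is small enough.\<close>
    proof (intro exI[of _ "max 1 (max T B)"] conjI allI impI)
      show "0 < max 1 (max T B)" by simp
      fix t :: real assume t: "max 1 (max T B) \<le> \<bar>t\<bar>"
      have "norm (y t) \<le> N * (2 * M) * exp (- \<nu> * (\<bar>t\<bar> - T)) + 2 * N * ?\<eta> / \<nu>"
        using right[of "\<bar>t\<bar>"] left[of "\<bar>t\<bar>"] t by (cases "0 \<le> t") auto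
      also have "\<dots> < C * \<epsilon>"
        unfolding C\<epsilon> using t by (intro add_strict_right_mono B) auto
      finally show "dist (x (t + s)) (x t) < C * \<epsilon>"
        by (simp add: y_def dist_norm)
    qed
  qed
qed

section \<open>Transfer of the remote properties to bounded solutions\<close>

lemma remotely_periodic_iff:
  "remotely_periodic \<tau> g \<longleftrightarrow> continuous_on UNIV g \<and>
    (\<forall>\<epsilon>>0. \<exists>L>0. \<forall>t. L \<le> \<bar>t\<bar> \<longrightarrow> dist (g (t + \<tau>)) (g t) < \<epsilon>)"
  by (auto simp: remotely_periodic_def tendsto_iff eventually_at_infinity_pos)

context
  fixes A :: "real \<Rightarrow> ('a::banach \<Rightarrow>\<^sub>L 'a)" and f x :: "real \<Rightarrow> 'a" and P Q :: "'a \<Rightarrow>\<^sub>L 'a"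
  assumes A: "continuous_on UNIV A" and tri: "exponential_trichotomy_with A P Q"
    and sol: "linear_ode_solution A f x" and bdd: "bounded (range x)"
begin

lemma bounded_solution_remotely_almost_periodic:
  assumes "remotely_almost_periodic (\<lambda>t. (A t, f t))"
  shows "remotely_almost_periodic x"
  unfolding remotely_almost_periodic_def
proof (intro conjI allI impI linear_ode_solution_continuous[OF sol])
  fix \<epsilon> :: real assume "\<epsilon> > 0"
  obtain C where "C > 0" and C: "\<forall>s \<epsilon> L. \<epsilon> > 0 \<longrightarrow>
      (\<forall>t. L \<le> \<bar>t\<bar> \<longrightarrow> dist (A (t + s), f (t + s)) (A t, f t) < \<epsilon>) \<longrightarrow>
      (\<exists>L'>0. \<forall>t. L' \<le> \<bar>t\<bar> \<longrightarrow> dist (x (t + s)) (x t) < C * \<epsilon>)"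
    using bounded_solution_shift_difference[OF A tri sol bdd] by blast
  have "\<epsilon> / C > 0" using \<open>\<epsilon> > 0\<close> \<open>C > 0\<close> by simp
  with assms obtain S where S: "relatively_dense S" "\<And>s. s \<in> S \<Longrightarrow>
      \<exists>L>0. \<forall>t. L \<le> \<bar>t\<bar> \<longrightarrow> dist (A (t + s), f (t + s)) (A t, f t) < \<epsilon> / C"
    unfolding remotely_almost_periodic_def by blast
  \<comment> \<open>The shifts belonging to \<open>\<epsilon> / C\<close> for the pair serve
    unchanged for \<open>x\<close>, with tolerance
    \<open>C * (\<epsilon> / C) = \<epsilon>\<close>.\<close>
  have "\<exists>L'>0. \<forall>t. L' \<le> \<bar>t\<bar> \<longrightarrow> dist (x (t + s)) (x t) < \<epsilon>" if "s \<in> S" for s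
    using S(2)[OF that] C[rule_format, OF \<open>\<epsilon> / C > 0\<close>, of _ s] \<open>C > 0\<close> by auto
  with S(1) show "\<exists>S. relatively_dense S \<and>
      (\<forall>s\<in>S. \<exists>L>0. \<forall>t. L \<le> \<bar>t\<bar> \<longrightarrow> dist (x (t + s)) (x t) < \<epsilon>)"
    by blast
qed

lemma bounded_solution_remotely_periodic:
  assumes "remotely_periodic \<tau> (\<lambda>t. (A t, f t))"
  shows "remotely_periodic \<tau> x"
  unfolding remotely_periodic_iff
proof (intro conjI allI impI linear_ode_solution_continuous[OF sol])
  fix \<epsilon> :: real assume "\<epsilon> > 0"
  obtain C where "C > 0" and C: "\<forall>s \<epsilon> L. \<epsilon> > 0 \<longrightarrow>
      (\<forall>t. L \<le> \<bar>t\<bar> \<longrightarrow> dist (A (t + s), f (t + s)) (A t, f t) < \<epsilon>) \<longrightarrow>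
      (\<exists>L'>0. \<forall>t. L' \<le> \<bar>t\<bar> \<longrightarrow> dist (x (t + s)) (x t) < C * \<epsilon>)"
    using bounded_solution_shift_difference[OF A tri sol bdd] by blast
  have "\<epsilon> / C > 0" using \<open>\<epsilon> > 0\<close> \<open>C > 0\<close> by simp
  with assms obtain L where "\<And>t. L \<le> \<bar>t\<bar> \<Longrightarrow> dist (A (t + \<tau>), f (t + \<tau>)) (A t, f t) < \<epsilon> / C"
    unfolding remotely_periodic_iff by blast
  from C[rule_format, OF \<open>\<epsilon> / C > 0\<close> this]
  show "\<exists>L>0. \<forall>t. L \<le> \<bar>t\<bar> \<longrightarrow> dist (x (t + \<tau>)) (x t) < \<epsilon>"
    using \<open>C > 0\<close> by simp
qed

lemma bounded_solution_remotely_stationary: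
  "remotely_stationary (\<lambda>t. (A t, f t)) \<Longrightarrow> remotely_stationary x"
  unfolding remotely_stationary_def by (blast intro: bounded_solution_remotely_periodic)

end

text \<open>Evaluation at \<open>0\<close> is continuous on the function space, so it maps the
  compact hull of translates onto a compact set. The translate by \<open>h\<close> is sent to
  \<open>g h\<close>, so this set contains the whole range of \<open>g\<close>.\<close>

lemma lagrange_stable_imp_bounded:
  fixes g :: "real \<Rightarrow> 'e::metric_space"
  assumes "lagrange_stable g"
  shows "bounded (range g)"
proof -
  have g: "continuous_on UNIV g" and
    comp: "compactin ucc_topology (ucc_topology closure_of {translate h g | h. h \<in> UNIV})"
    using assms by (auto simp: lagrange_stable_def)
  have eval: "continuous_map ucc_topology euclidean (\<lambda>u :: real \<Rightarrow> 'e. u 0)"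
    unfolding continuous_map_def
  proof (intro conjI allI impI)
    fix W :: "'e set" assume "openin euclidean W"
    then have W: "open W" by simp
    show "openin ucc_topology {u \<in> topspace ucc_topology. u 0 \<in> W}"
      unfolding openin_ucc_topology topspace_ucc_topology ucc_open_def
    proof (intro conjI ballI)
      fix u :: "real \<Rightarrow> 'e" assume "u \<in> {u \<in> {g. continuous_on UNIV g}. u 0 \<in> W}"
      then obtain e where "e > 0" "ball (u 0) e \<subseteq> W"
        using W open_contains_ball by blast
      then show "\<exists>K \<epsilon>. compact K \<and> \<epsilon> > 0 \<and> {h. continuous_on UNIV h \<and> (\<forall>t\<in>K. dist (h t) (u t) < \<epsilon>)}
          \<subseteq> {u \<in> {g. continuous_on UNIV g}. u 0 \<in> W}"
        by (intro exI[of _ "{0}"] exI[of _ e]) (auto simp: dist_commute subset_iff)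
    qed auto
  qed simp
  have "compact ((\<lambda>u. u 0) ` (ucc_topology closure_of {translate h g | h. h \<in> UNIV}))"
    using image_compactin[OF comp eval] by simp
  then have "bounded ((\<lambda>u. u 0) ` (ucc_topology closure_of {translate h g | h. h \<in> UNIV}))"
    by (rule compact_imp_bounded)
  moreover have "range g \<subseteq> (\<lambda>u. u 0) ` (ucc_topology closure_of {translate h g | h. h \<in> UNIV})"
  proof
    fix y assume "y \<in> range g"
    then obtain h where "y = g h" by blast
    \<comment> \<open>A set lies in its closure only if it lies in the underlying space, here the
      continuous functions.\<close>
    have "{translate h g | h. h \<in> UNIV} \<subseteq> topspace ucc_topology"
      unfolding topspace_ucc_topology translate_def
      by (auto intro!: continuous_on_compose2[OF g] continuous_intros)
    then have "translate h g \<in> ucc_topology closure_of {translate h g | h. h \<in> UNIV}"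
      using closure_of_subset by blast
    then show "y \<in> (\<lambda>u. u 0) ` (ucc_topology closure_of {translate h g | h. h \<in> UNIV})"
      by (rule rev_image_eqI) (simp add: translate_def \<open>y = g h\<close>)
  qed
  ultimately show ?thesis by (rule bounded_subset)
qed

theorem theorem5p9:
  fixes A :: "real \<Rightarrow> ('a::banach \<Rightarrow>\<^sub>L 'a)" and f :: "real \<Rightarrow> 'a"
    and P Q :: "'a \<Rightarrow>\<^sub>L 'a" and \<tau>\<^sub>0 :: real
  assumes "continuous_on UNIV A" and "continuous_on UNIV f"
    and "\<tau>\<^sub>0 > 0"
    and "lagrange_stable (\<lambda>t. (A t, f t))"
    and "exponential_trichotomy_with A P Q"
  shows
    "(remotely_almost_periodic (\<lambda>t. (A t, f t)) \<longrightarrow>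
       (\<exists>\<phi>. linear_ode_solution A f \<phi> \<and> remotely_almost_periodic \<phi> \<and>
          (\<forall>t. ((\<lambda>\<tau>. blinfun_apply (green_function A P Q t \<tau>) (f \<tau>)) has_integral \<phi> t) UNIV)) \<and>
       (\<forall>x. linear_ode_solution A f x \<and> bounded (range x) \<longrightarrow> remotely_almost_periodic x)) \<and>
     (remotely_periodic \<tau>\<^sub>0 (\<lambda>t. (A t, f t)) \<longrightarrow>
       (\<exists>\<phi>. linear_ode_solution A f \<phi> \<and> remotely_periodic \<tau>\<^sub>0 \<phi> \<and>
          (\<forall>t. ((\<lambda>\<tau>. blinfun_apply (green_function A P Q t \<tau>) (f \<tau>)) has_integral \<phi> t) UNIV)) \<and>
       (\<forall>x. linear_ode_solution A f x \<and> bounded (range x) \<longrightarrow> remotely_periodic \<tau>\<^sub>0 x)) \<and>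
     (remotely_stationary (\<lambda>t. (A t, f t)) \<longrightarrow>
       (\<exists>\<phi>. linear_ode_solution A f \<phi> \<and> remotely_stationary \<phi> \<and>
          (\<forall>t. ((\<lambda>\<tau>. blinfun_apply (green_function A P Q t \<tau>) (f \<tau>)) has_integral \<phi> t) UNIV)) \<and>
       (\<forall>x. linear_ode_solution A f x \<and> bounded (range x) \<longrightarrow> remotely_stationary x))"
proof -
  have "bounded (range (\<lambda>t. (A t, f t)))"
    using assms(4) by (rule lagrange_stable_imp_bounded)
  from bounded_snd[OF this] have "bounded (range f)"
    by (simp add: image_image)
  then obtain \<phi> where "linear_ode_solution A f \<phi>" "bounded (range \<phi>)"
    "\<forall>t. ((\<lambda>\<tau>. blinfun_apply (green_function A P Q t \<tau>) (f \<tau>)) has_integral \<phi> t) UNIV"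
    using green_integral_solution[OF assms(1,2) _ assms(5)] by blast
  \<comment> \<open>The Green integral is itself a bounded solution, so one \<open>\<phi>\<close>
    serves all three classes, and its remote behaviour is an instance of the claim about bounded
    solutions.\<close>
  then show ?thesis
    using bounded_solution_remotely_almost_periodic[OF assms(1,5)]
      bounded_solution_remotely_periodic[OF assms(1,5)]
      bounded_solution_remotely_stationary[OF assms(1,5)]
    by blast
qed

end
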